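(* Let $E_1=\mathbb{R}^m$, $E_2=\mathbb{R}^k$, and let $(X_n)$ and $(Y_n)$ be sequences of random vectors in $\mathbb{R}^m$ and $\mathbb{R}^k$ respectively, all defined on one probability space. Suppose that the sequences of distributions $(P_{X_n})$ and $(P_{Y_n})$ are tight. The following conditions are equivalent: 1) AI-1 holds for $(X_n),(Y_n)$. 2) For all $\overline{t}\in\mathbb{R}^m$, $\overline{s}\in\mathbb{R}^k$, $$\phi_{(X_n,Y_n)}(\overline{t},\overline{s})-\phi_{X_n}(\overline{t})\,\phi_{Y_n}(\overline{s})\to 0,\qquad n\to+\infty,$$ where $\phi_\xi$ denotes the characteristic function of a random vector $\xi$.
   Context: $P_\xi$ denotes the distribution of $\xi$; $\mathbb{R}^m,\mathbb{R}^k$ carry their Euclidean metrics and $\mathbb{R}^m\times\mathbb{R}^k$ the sum (equivalently, maximum) metric. AI-1: for all bounded uniformly continuous functions $h:\mathbb{R}^m\times\mathbb{R}^k\to\mathbb{R}$, $\int h(x,y)\,P_{(X_n,Y_n)}(dx,dy)-\int h(x,y)\,(P_{X_n}\times P_{Y_n})(dx,dy)\to 0$ as $n\to+\infty$. *)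

theory Defs
  imports "HOL-Probability.Probability"
begin

text \<open>
  Compact-set tightness of a sequence of Borel probability measures. The constant
  \<^const>\<open>tight\<close> of the library only covers measures on the real line.
\<close>
definition tight_seq :: "(nat \<Rightarrow> 'a::topological_space measure) \<Rightarrow> bool" where
  "tight_seq \<mu> \<longleftrightarrow> (\<forall>\<epsilon>>0. \<exists>K. compact K \<and> (\<forall>n. measure (\<mu> n) K \<ge> 1 - \<epsilon>))"

text \<open>
  Likewise \<^const>\<open>char\<close> is restricted to the real line. On a product type the
  inner product is the sum of the inner products of the components, so for a pair
  this is the expectation of \<open>exp (\<i> * ((t \<bullet> x) + (s \<bullet> y)))\<close>.
\<close>
definition char_vec :: "'a::euclidean_space measure \<Rightarrow> 'a \<Rightarrow> complex" where
  "char_vec \<mu> t = (LINT x|\<mu>. iexp (t \<bullet> x))"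

text \<open>
  Uniform continuity is taken with respect to the library metric on the product type;
  \<open>uniformly_continuous_on_prod_sum_dist\<close> below shows that the sum metric gives the same
  notion. By second countability the product of the Borel sigma-algebras, which carries
  the product measure, is the Borel sigma-algebra of the product.
\<close>
definition AI1 ::
  "'w measure \<Rightarrow> (nat \<Rightarrow> 'w \<Rightarrow> 'a::{metric_space, second_countable_topology})
    \<Rightarrow> (nat \<Rightarrow> 'w \<Rightarrow> 'b::{metric_space, second_countable_topology}) \<Rightarrow> bool" where
  "AI1 M X Y \<longleftrightarrow>
    (\<forall>h :: 'a \<times> 'b \<Rightarrow> real. bounded (range h) \<and> uniformly_continuous_on UNIV h \<longrightarrow>
      (\<lambda>n. (LINT z|distr M borel (\<lambda>\<omega>. (X n \<omega>, Y n \<omega>)). h z)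
         - (LINT z|(distr M borel (X n) \<Otimes>\<^sub>M distr M borel (Y n)). h z)) \<longlonglongrightarrow> 0)"

lemma uniformly_continuous_on_prod_sum_dist:
  fixes h :: "'a::metric_space \<times> 'b::metric_space \<Rightarrow> real"
  shows "uniformly_continuous_on UNIV h \<longleftrightarrow>
    (\<forall>e>0. \<exists>d>0. \<forall>x x' y y'. dist x x' + dist y y' < d \<longrightarrow> dist (h (x, y)) (h (x', y')) < e)"
    (is "?L \<longleftrightarrow> ?R")
proof
  assume L: ?L
  have le: "dist (x, y) (x', y') \<le> dist x x' + dist y y'" for x x' :: 'a and y y' :: 'b
    by (simp add: dist_Pair_Pair sqrt_sum_squares_le_sum)
  show ?R
  proof (intro allI impI)
    fix e :: real assume "e > 0"
    with L obtain d where d: "d > 0" "\<And>z z'. dist z' z < d \<Longrightarrow> dist (h z') (h z) < e"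
      unfolding uniformly_continuous_on_def by blast
    then show "\<exists>d>0. \<forall>x x' y y'. dist x x' + dist y y' < d \<longrightarrow> dist (h (x, y)) (h (x', y')) < e"
      using le by (meson le_less_trans)
  qed
next
  assume R: ?R
  show ?L
    unfolding uniformly_continuous_on_def
  proof (intro allI impI)
    fix e :: real assume "e > 0"
    with R obtain d where d: "d > 0"
      "\<And>x x' y y'. dist x x' + dist y y' < d \<Longrightarrow> dist (h (x, y)) (h (x', y')) < e"
      by blast
    have "dist (h z') (h z) < e" if "dist z' z < d / 2" for z z'
    proof -
      have "dist (fst z') (fst z) < d / 2" "dist (snd z') (snd z) < d / 2"
        using that dist_fst_le[of z' z] dist_snd_le[of z' z] by linarith+
      then have "dist (fst z') (fst z) + dist (snd z') (snd z) < d" by linarith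
      from d(2)[OF this] show ?thesis by simp
    qed
    then show "\<exists>d>0. \<forall>x\<in>UNIV. \<forall>x'\<in>UNIV. dist x' x < d \<longrightarrow> dist (h x') (h x) < e"
      using d(1) by (intro exI[of _ "d / 2"]) auto
  qed
qed

end

theory Submission
  imports Defs
begin

text \<open>
  Let \<open>\<mu>\<^sub>n\<close> be the joint law of \<open>(X\<^sub>n, Y\<^sub>n)\<close> and \<open>\<nu>\<^sub>n\<close> the product of the two marginal laws. The
  characteristic function of \<open>\<nu>\<^sub>n\<close> is the product of those of the marginals, so both conditions
  say that \<open>\<integral>h d\<mu>\<^sub>n - \<integral>h d\<nu>\<^sub>n\<close> tends to \<open>0\<close>: the first for all bounded uniformly continuous
  real \<open>h\<close>, the second for all characters \<open>h\<close>. One implication is then immediate, because the real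
  and imaginary parts of a character are bounded and Lipschitz.

  For the converse, both \<open>(\<mu>\<^sub>n)\<close> and \<open>(\<nu>\<^sub>n)\<close> are tight, since the marginals are. Convergence for
  characters extends by linearity to trigonometric polynomials. It therefore suffices to find, for
  each bounded continuous \<open>h\<close> and each compact \<open>K\<close>, a trigonometric polynomial that is uniformly
  close to \<open>h\<close> on \<open>K\<close> and bounded on the whole space independently of \<open>K\<close>
  (\<open>trig_poly_approx\<close>): on \<open>K\<close> the error is small, and off \<open>K\<close> it is bounded while the mass is
  small. For the approximation, choose \<open>c > 0\<close> such that \<open>z \<mapsto> (sin (c z\<^sub>i))\<^sub>i\<close> is injective on a
  cube containing \<open>K\<close>. Its inverse is given by the arcsine and is continuous on all of
  \<open>[-1, 1]\<^sup>d\<close>, so \<open>h\<close> composed with that inverse is uniformly close on this cube to an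
  ordinary polynomial \<open>P\<close>. Then \<open>P ((sin (c z\<^sub>i))\<^sub>i)\<close> is a trigonometric polynomial with the
  required properties; the global bound holds because the sines never leave \<open>[-1, 1]\<close>.
\<close>

section \<open>Trigonometric polynomials\<close>

text \<open>
  Trigonometric polynomials: finite complex linear combinations of characters, with arbitrary
  real frequency vectors.
\<close>
inductive trig_poly :: "('a::euclidean_space \<Rightarrow> complex) \<Rightarrow> bool" where
  monomial: "trig_poly (\<lambda>x. c * iexp (t \<bullet> x))"
| add: "trig_poly f \<Longrightarrow> trig_poly g \<Longrightarrow> trig_poly (\<lambda>x. f x + g x)"

lemma trig_poly_const: "trig_poly (\<lambda>x. c)"
  using monomial[of c 0] by simp

lemma trig_poly_mult:
  assumes "trig_poly f" "trig_poly g"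
  shows "trig_poly (\<lambda>x. f x * g x)"
  using assms(1)
proof induction
  case (monomial c t)
  show ?case
    using assms(2)
  proof induction
    case (monomial d s)
    have "(\<lambda>x. c * iexp (t \<bullet> x) * (d * iexp (s \<bullet> x))) = (\<lambda>x. (c * d) * iexp ((t + s) \<bullet> x))"
      by (auto simp: inner_add_left distrib_left exp_add)
    then show ?case using trig_poly.monomial[of "c * d" "t + s"] by simp
  next
    case (add f g)
    then show ?case using trig_poly.add by (simp add: distrib_left)
  qed
next
  case (add f g)
  then show ?case using trig_poly.add by (simp add: distrib_right)
qed

lemma trig_poly_sum:
  assumes "finite I" "\<And>i. i \<in> I \<Longrightarrow> trig_poly (f i)"
  shows "trig_poly (\<lambda>x. \<Sum>i\<in>I. f i x)"
  using assms by (induction I) (auto intro: trig_poly_const trig_poly.add)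

lemma trig_poly_sin: "trig_poly (\<lambda>x. complex_of_real (sin (c * (x \<bullet> b))))"
proof -
  have "complex_of_real (sin (c * (x \<bullet> b)))
      = 1 / (2 * \<i>) * iexp ((c *\<^sub>R b) \<bullet> x) + - 1 / (2 * \<i>) * iexp (((- c) *\<^sub>R b) \<bullet> x)" for x
    by (simp add: sin_of_real[symmetric] sin_exp_eq inner_commute[of x b] field_simps exp_minus)
  then show ?thesis by (simp only: trig_poly.intros)
qed

lemma trig_poly_continuous: "trig_poly f \<Longrightarrow> continuous_on UNIV f"
  by (induction rule: trig_poly.induct) (auto intro!: continuous_intros)

text \<open>The map that replaces each coordinate \<open>z\<^sub>i\<close> by \<open>sin (c z\<^sub>i)\<close>.\<close>
definition coord_sin :: "real \<Rightarrow> 'a::euclidean_space \<Rightarrow> 'a" where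
  "coord_sin c z = (\<Sum>b\<in>Basis. sin (c * (z \<bullet> b)) *\<^sub>R b)"

lemma trig_poly_polynomial_coord_sin:
  assumes "real_polynomial_function P"
  shows "trig_poly (\<lambda>z. complex_of_real (P (coord_sin c z)))"
  using assms
proof induction
  case (linear f)
  then interpret bounded_linear f .
  have "complex_of_real (f (coord_sin c z))
      = (\<Sum>b\<in>Basis. complex_of_real (sin (c * (z \<bullet> b))) * complex_of_real (f b))" for z
    by (simp add: coord_sin_def sum scale)
  then show ?case
    by (simp only:) (intro trig_poly_sum trig_poly_mult trig_poly_sin trig_poly_const finite_Basis)
next
  case (const c)
  show ?case by (rule trig_poly_const)
next
  case (add f g)
  then show ?case by (simp add: trig_poly.add)
next
  case (mult f g)
  then show ?case by (simp add: trig_poly_mult)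
qed

text \<open>
  The bound on \<open>p\<close> holds on the whole space and does not depend on \<open>K\<close>. This is what
  makes the approximation usable together with tightness.
\<close>
lemma trig_poly_approx:
  fixes h :: "'a::euclidean_space \<Rightarrow> real"
  assumes h: "continuous_on UNIV h" and B: "\<And>z. \<bar>h z\<bar> \<le> B"
    and K: "compact K" and \<epsilon>: "\<epsilon> > 0"
  obtains p where "trig_poly (\<lambda>z. complex_of_real (p z))"
    "\<And>z. \<bar>p z\<bar> \<le> B + \<epsilon>" "\<And>z. z \<in> K \<Longrightarrow> \<bar>h z - p z\<bar> \<le> \<epsilon>"
proof -
  obtain R where R: "R > 0" "\<And>z. z \<in> K \<Longrightarrow> norm z \<le> R"
    using compact_imp_bounded[OF K] bounded_pos by metis
  \<comment> \<open>With this \<open>c\<close>, scaling by \<open>c\<close> takes \<open>[-R, R]\<close> onto \<open>[-pi/2, pi/2]\<close>, where the arcsine inverts the sine.\<close>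
  define c where "c = pi / (2 * R)"
  have c: "c > 0" "c * R = pi / 2" using R by (simp_all add: c_def)
  define A :: "'a \<Rightarrow> 'a" where "A s = (\<Sum>b\<in>Basis. (arcsin (s \<bullet> b) / c) *\<^sub>R b)" for s
  define Q :: "'a set" where "Q = cbox (- One) One"
  have Q: "\<bar>s \<bullet> b\<bar> \<le> 1" if "s \<in> Q" "b \<in> Basis" for s b
    using that by (auto simp: Q_def mem_box abs_le_iff algebra_simps)
  have "continuous_on Q A"
    unfolding A_def using Q c
    by (intro continuous_intros ballI) (force simp: abs_le_iff)+
  then have "continuous_on Q (\<lambda>s. h (A s))"
    using continuous_on_compose2[OF h] by blast
  then obtain P where P: "real_polynomial_function P" "\<And>s. s \<in> Q \<Longrightarrow> \<bar>h (A s) - P s\<bar> < \<epsilon>"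
    using Stone_Weierstrass_real_polynomial_function[of Q "\<lambda>s. h (A s)" \<epsilon>] \<epsilon>
    unfolding Q_def by (metis compact_cbox)
  have S: "coord_sin c z \<in> Q" for z :: 'a
    by (auto simp: Q_def mem_box coord_sin_def inner_sum_left inner_Basis sum.delta if_distrib cong: if_cong)
  have AS: "A (coord_sin c z) = z" if "z \<in> K" for z
  proof (rule euclidean_eqI)
    fix b :: 'a assume b: "b \<in> Basis"
    have "\<bar>z \<bullet> b\<bar> \<le> R" using Basis_le_norm[OF b, of z] R(2)[OF that] by linarith
    then have "\<bar>c * (z \<bullet> b)\<bar> \<le> pi / 2"
      using c by (metis abs_mult abs_of_pos mult_le_cancel_left_pos)
    then have "arcsin (sin (c * (z \<bullet> b))) = c * (z \<bullet> b)"
      by (intro arcsin_sin) (auto simp: abs_le_iff)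
    then show "A (coord_sin c z) \<bullet> b = z \<bullet> b"
      using b c by (simp add: A_def coord_sin_def inner_sum_left_Basis)
  qed
  show ?thesis
  proof (rule that)
    show "trig_poly (\<lambda>z. complex_of_real (P (coord_sin c z)))"
      by (rule trig_poly_polynomial_coord_sin[OF P(1)])
    show "\<bar>P (coord_sin c z)\<bar> \<le> B + \<epsilon>" for z
      using P(2)[OF S, of z] B[of "A (coord_sin c z)"] by linarith
    show "\<bar>h z - P (coord_sin c z)\<bar> \<le> \<epsilon>" if "z \<in> K" for z
      using P(2)[OF S, of z] AS[OF that] by simp
  qed
qed

section \<open>Comparing integrals through characteristic functions\<close>

lemma prob_integrable_continuous_bounded:
  fixes f :: "'a::second_countable_topology \<Rightarrow> 'b::{banach, second_countable_topology}"
  assumes "prob_space \<mu>" "sets \<mu> = sets borel" "continuous_on UNIV f" "\<And>z. norm (f z) \<le> B"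
  shows "integrable \<mu> f"
proof -
  interpret prob_space \<mu> by fact
  have "f \<in> borel_measurable \<mu>"
    using borel_measurable_continuous_onI[OF assms(3)] measurable_cong_sets[OF assms(2) refl] by auto
  then show ?thesis using assms(4) by (intro integrable_const_bound[of _ B]) auto
qed

lemma integrable_trig_poly:
  assumes \<mu>: "prob_space \<mu>" "sets \<mu> = sets borel" and "trig_poly f"
  shows "integrable \<mu> f"
  using assms(3)
proof induction
  case (monomial c t)
  show ?case
    by (rule prob_integrable_continuous_bounded[OF \<mu>, of _ "norm c"])
       (auto intro!: continuous_intros simp: norm_mult)
qed auto

lemma integral_trig_poly_diff_tendsto:
  fixes \<mu> \<nu> :: "nat \<Rightarrow> 'a::euclidean_space measure"
  assumes \<mu>: "\<And>n. prob_space (\<mu> n)" "\<And>n. sets (\<mu> n) = sets borel"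
    and \<nu>: "\<And>n. prob_space (\<nu> n)" "\<And>n. sets (\<nu> n) = sets borel"
    and char: "\<And>t. (\<lambda>n. char_vec (\<mu> n) t - char_vec (\<nu> n) t) \<longlonglongrightarrow> 0"
    and "trig_poly f"
  shows "(\<lambda>n. (LINT z|\<mu> n. f z) - (LINT z|\<nu> n. f z)) \<longlonglongrightarrow> 0"
  using assms(6)
proof induction
  case (monomial c t)
  have "(\<lambda>n. c * (char_vec (\<mu> n) t - char_vec (\<nu> n) t)) \<longlonglongrightarrow> 0"
    using tendsto_mult_right_zero[OF char] by simp
  then show ?case by (simp add: char_vec_def right_diff_distrib)
next
  case (add f g)
  note int = integrable_trig_poly[OF \<mu>] integrable_trig_poly[OF \<nu>]
  show ?case
    using tendsto_add[OF add.IH] add.hyps by (simp add: int algebra_simps)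
qed

lemma integral_approx_error:
  fixes h p :: "'a::{second_countable_topology, t2_space} \<Rightarrow> real"
  assumes \<mu>: "prob_space \<mu>" "sets \<mu> = sets borel"
    and int: "integrable \<mu> h" "integrable \<mu> p" and K: "compact K"
    and C: "\<And>z. \<bar>h z - p z\<bar> \<le> C" and \<epsilon>: "\<epsilon> \<ge> 0" "\<And>z. z \<in> K \<Longrightarrow> \<bar>h z - p z\<bar> \<le> \<epsilon>"
  shows "\<bar>(LINT z|\<mu>. h z) - (LINT z|\<mu>. p z)\<bar> \<le> \<epsilon> + C * (1 - measure \<mu> K)"
proof -
  interpret prob_space \<mu> by fact
  have sp: "space \<mu> = UNIV" using sets_eq_imp_space_eq[OF \<mu>(2)] by simp
  have Kb: "K \<in> sets \<mu>" using K \<mu>(2) by (simp add: borel_compact)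
  have KC: "- K \<in> sets \<mu>" using sets.compl_sets[OF Kb] sp by (simp add: Compl_eq_Diff_UNIV)
  have ind: "integrable \<mu> (indicat_real (- K))"
    using KC by (intro integrable_real_indicator) (auto simp: less_top[symmetric])
  have "\<bar>(LINT z|\<mu>. h z) - (LINT z|\<mu>. p z)\<bar> = \<bar>LINT z|\<mu>. h z - p z\<bar>"
    using int by simp
  also have "\<dots> \<le> (LINT z|\<mu>. \<bar>h z - p z\<bar>)" by (rule integral_abs_bound)
  also have "\<dots> \<le> (LINT z|\<mu>. \<epsilon> + C * indicator (- K) z)"
  proof (rule integral_mono)
    show "integrable \<mu> (\<lambda>z. \<epsilon> + C * indicator (- K) z)" using ind by simp
    show "\<bar>h z - p z\<bar> \<le> \<epsilon> + C * indicator (- K) z" for z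
      using \<epsilon>(1) \<epsilon>(2)[of z] C[of z] by (auto simp: indicator_def)
  qed (use int in simp)
  also have "\<dots> = \<epsilon> + C * measure \<mu> (- K)"
    using ind prob_space by (simp add: sp)
  also have "measure \<mu> (- K) = 1 - measure \<mu> K"
    using prob_compl[OF Kb] sp by (simp add: Compl_eq_Diff_UNIV)
  finally show ?thesis .
qed

text \<open>
  A continuity theorem without limit laws: neither sequence is assumed to converge.
\<close>
lemma integral_diff_tendsto_if_char_vec_diff_tendsto:
  fixes \<mu> \<nu> :: "nat \<Rightarrow> 'a::euclidean_space measure"
  assumes \<mu>: "\<And>n. prob_space (\<mu> n)" "\<And>n. sets (\<mu> n) = sets borel"
    and \<nu>: "\<And>n. prob_space (\<nu> n)" "\<And>n. sets (\<nu> n) = sets borel"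
    and tight: "tight_seq \<mu>" "tight_seq \<nu>"
    and char: "\<And>t. (\<lambda>n. char_vec (\<mu> n) t - char_vec (\<nu> n) t) \<longlonglongrightarrow> 0"
    and h: "continuous_on UNIV h" "bounded (range h)"
  shows "(\<lambda>n. (LINT z|\<mu> n. h z) - (LINT z|\<nu> n. h z :: real)) \<longlonglongrightarrow> 0"
proof (rule LIMSEQ_I)
  fix r :: real assume r: "r > 0"
  obtain B where B: "B > 0" "\<And>z. \<bar>h z\<bar> \<le> B"
    using h(2) by (auto simp: bounded_pos)
  \<comment> \<open>\<open>C\<close> will bound \<open>\<bar>h - p\<bar>\<close> everywhere. Each of \<open>\<mu> n\<close> and \<open>\<nu> n\<close> then contributes an error of at most
    \<open>\<epsilon> + C * \<delta> = 2 * \<epsilon>\<close>, and the integrals of \<open>p\<close> eventually differ by less than \<open>\<epsilon>\<close>;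
    in total, \<open>5 * \<epsilon> < r\<close>.\<close>
  define \<epsilon> where "\<epsilon> = r / 8"
  define C where "C = 2 * B + \<epsilon>"
  define \<delta> where "\<delta> = \<epsilon> / C"
  have pos: "\<epsilon> > 0" "C > 0" "\<delta> > 0" and C\<delta>: "C * \<delta> = \<epsilon>"
  proof -
    show "\<epsilon> > 0" using r by (simp add: \<epsilon>_def)
    moreover from this show "C > 0" using B by (simp add: C_def)
    ultimately show "\<delta> > 0" "C * \<delta> = \<epsilon>" by (simp_all add: \<delta>_def)
  qed
  obtain K1 where K1: "compact K1" "\<And>n. measure (\<mu> n) K1 \<ge> 1 - \<delta>"
    using tight(1) pos unfolding tight_seq_def by blast
  obtain K2 where K2: "compact K2" "\<And>n. measure (\<nu> n) K2 \<ge> 1 - \<delta>"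
    using tight(2) pos unfolding tight_seq_def by blast
  obtain p where p: "trig_poly (\<lambda>z. complex_of_real (p z))"
    "\<And>z. \<bar>p z\<bar> \<le> B + \<epsilon>" "\<And>z. z \<in> K1 \<union> K2 \<Longrightarrow> \<bar>h z - p z\<bar> \<le> \<epsilon>"
    using trig_poly_approx[OF h(1) B(2) compact_Un[OF K1(1) K2(1)] pos(1)] by blast
  have pc: "continuous_on UNIV p"
    using continuous_on_Re[OF trig_poly_continuous[OF p(1)]] by simp
  have err: "\<bar>(LINT z|\<rho>. h z) - (LINT z|\<rho>. p z)\<bar> \<le> 2 * \<epsilon>"
    if \<rho>: "prob_space \<rho>" "sets \<rho> = sets borel"
      and K: "compact K" "K \<subseteq> K1 \<union> K2" "measure \<rho> K \<ge> 1 - \<delta>" for \<rho> K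
  proof -
    have "\<bar>(LINT z|\<rho>. h z) - (LINT z|\<rho>. p z)\<bar> \<le> \<epsilon> + C * (1 - measure \<rho> K)"
    proof (rule integral_approx_error[OF \<rho> _ _ K(1)])
      show "integrable \<rho> h"
        using B by (intro prob_integrable_continuous_bounded[OF \<rho> h(1), of B]) auto
      show "integrable \<rho> p"
        using p by (intro prob_integrable_continuous_bounded[OF \<rho> pc, of "B + \<epsilon>"]) auto
      show "\<bar>h z - p z\<bar> \<le> C" for z
        using B(2)[of z] p(2)[of z] by (simp add: C_def)
    qed (use K p pos in auto)
    also have "C * (1 - measure \<rho> K) \<le> C * \<delta>"
      using K pos by (intro mult_left_mono) auto
    finally show ?thesis using C\<delta> by simp
  qed
  have "(\<lambda>n. Re ((LINT z|\<mu> n. complex_of_real (p z)) - (LINT z|\<nu> n. complex_of_real (p z)))) \<longlonglongrightarrow> Re 0"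
    by (intro tendsto_Re integral_trig_poly_diff_tendsto[OF \<mu> \<nu> char p(1)])
  then have "(\<lambda>n. (LINT z|\<mu> n. p z) - (LINT z|\<nu> n. p z)) \<longlonglongrightarrow> 0" by simp
  then obtain N where N: "\<And>n. n \<ge> N \<Longrightarrow> \<bar>(LINT z|\<mu> n. p z) - (LINT z|\<nu> n. p z)\<bar> < \<epsilon>"
    using pos LIMSEQ_D[of _ 0 \<epsilon>] by fastforce
  have "\<bar>(LINT z|\<mu> n. h z) - (LINT z|\<nu> n. h z)\<bar> < r" if "n \<ge> N" for n
    using N[OF that] err[OF \<mu> K1(1) Un_upper1 K1(2), of n] err[OF \<nu> K2(1) Un_upper2 K2(2), of n] r
    unfolding \<epsilon>_def by linarith
  then show "\<exists>N. \<forall>n\<ge>N. norm ((LINT z|\<mu> n. h z) - (LINT z|\<nu> n. h z) - 0) < r" by auto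
qed

section \<open>Joint laws and product laws\<close>

lemma sets_pair_borel:
  fixes \<mu> :: "'a::second_countable_topology measure" and \<nu> :: "'b::second_countable_topology measure"
  assumes "sets \<mu> = sets borel" "sets \<nu> = sets borel"
  shows "sets (\<mu> \<Otimes>\<^sub>M \<nu>) = sets borel"
  using sets_pair_measure_cong[OF assms] by (simp only: borel_prod)

lemma tight_seq_pair_measure:
  fixes \<mu> :: "nat \<Rightarrow> 'a::{second_countable_topology, t2_space} measure"
    and \<nu> :: "nat \<Rightarrow> 'b::{second_countable_topology, t2_space} measure"
  assumes \<mu>: "\<And>n. prob_space (\<mu> n)" "\<And>n. sets (\<mu> n) = sets borel" "tight_seq \<mu>"
    and \<nu>: "\<And>n. prob_space (\<nu> n)" "\<And>n. sets (\<nu> n) = sets borel" "tight_seq \<nu>"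
  shows "tight_seq (\<lambda>n. \<mu> n \<Otimes>\<^sub>M \<nu> n)"
  unfolding tight_seq_def
proof (intro allI impI)
  fix \<epsilon> :: real assume \<epsilon>: "\<epsilon> > 0"
  define \<delta> where "\<delta> = min (\<epsilon> / 2) 1"
  have \<delta>: "\<delta> > 0" "\<delta> \<le> 1" "2 * \<delta> \<le> \<epsilon>" using \<epsilon> by (auto simp: \<delta>_def)
  obtain K where K: "compact K" "\<And>n. measure (\<mu> n) K \<ge> 1 - \<delta>"
    using \<mu>(3) \<delta> unfolding tight_seq_def by blast
  obtain L where L: "compact L" "\<And>n. measure (\<nu> n) L \<ge> 1 - \<delta>"
    using \<nu>(3) \<delta> unfolding tight_seq_def by blast
  have "measure (\<mu> n \<Otimes>\<^sub>M \<nu> n) (K \<times> L) \<ge> 1 - \<epsilon>" for n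
  proof -
    interpret A: prob_space "\<mu> n" by (rule \<mu>)
    interpret B: prob_space "\<nu> n" by (rule \<nu>)
    have "1 - \<epsilon> \<le> (1 - \<delta>) * (1 - \<delta>)" using \<delta> by (simp add: algebra_simps) (smt (verit) mult_nonneg_nonneg)
    also have "\<dots> \<le> measure (\<mu> n) K * measure (\<nu> n) L"
      using K L \<delta> by (intro mult_mono) auto
    also have "\<dots> = measure (\<mu> n \<Otimes>\<^sub>M \<nu> n) (K \<times> L)"
      using borel_compact[OF K(1)] borel_compact[OF L(1)] \<mu>(2)[of n] \<nu>(2)[of n]
      by (simp add: measure_def B.emeasure_pair_measure_Times enn2real_mult)
    finally show ?thesis .
  qed
  then show "\<exists>K. compact K \<and> (\<forall>n. measure (\<mu> n \<Otimes>\<^sub>M \<nu> n) K \<ge> 1 - \<epsilon>)"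
    using compact_Times[OF K(1) L(1)] by blast
qed

lemma tight_seq_distr_Pair:
  fixes X :: "nat \<Rightarrow> 'w \<Rightarrow> 'a::{second_countable_topology, t2_space}"
    and Y :: "nat \<Rightarrow> 'w \<Rightarrow> 'b::{second_countable_topology, t2_space}"
  assumes "prob_space M"
    and X: "\<And>n. X n \<in> borel_measurable M" and Y: "\<And>n. Y n \<in> borel_measurable M"
    and tX: "tight_seq (\<lambda>n. distr M borel (X n))" and tY: "tight_seq (\<lambda>n. distr M borel (Y n))"
  shows "tight_seq (\<lambda>n. distr M borel (\<lambda>\<omega>. (X n \<omega>, Y n \<omega>)))"
  unfolding tight_seq_def
proof (intro allI impI)
  fix \<epsilon> :: real assume \<epsilon>: "\<epsilon> > 0"
  interpret prob_space M by fact
  obtain K where K: "compact K" "\<And>n. measure (distr M borel (X n)) K \<ge> 1 - \<epsilon> / 2"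
    using tX \<epsilon> unfolding tight_seq_def by (meson half_gt_zero)
  obtain L where L: "compact L" "\<And>n. measure (distr M borel (Y n)) L \<ge> 1 - \<epsilon> / 2"
    using tY \<epsilon> unfolding tight_seq_def by (meson half_gt_zero)
  have "measure (distr M borel (\<lambda>\<omega>. (X n \<omega>, Y n \<omega>))) (K \<times> L) \<ge> 1 - \<epsilon>" for n
  proof -
    let ?A = "X n -` K \<inter> space M" and ?B = "Y n -` L \<inter> space M"
    have A: "?A \<in> events" "?B \<in> events"
      using X Y borel_compact[OF K(1)] borel_compact[OF L(1)] by (auto intro: measurable_sets)
    \<comment> \<open>Bonferroni's inequality, so that no independence is needed.\<close>
    have "prob ?A + prob ?B - prob (?A \<inter> ?B) = prob (?A \<union> ?B)"
      using finite_measure_Union'[OF A] finite_measure_Diff'[OF A(2,1)] by (simp add: Int_commute)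
    then have "prob ?A + prob ?B - 1 \<le> prob (?A \<inter> ?B)"
      using prob_le_1[of "?A \<union> ?B"] by linarith
    also have "?A \<inter> ?B = (\<lambda>\<omega>. (X n \<omega>, Y n \<omega>)) -` (K \<times> L) \<inter> space M" by auto
    also have "prob \<dots> = measure (distr M borel (\<lambda>\<omega>. (X n \<omega>, Y n \<omega>))) (K \<times> L)"
      using X Y borel_compact[OF compact_Times[OF K(1) L(1)]] by (subst measure_distr) auto
    finally show ?thesis
      using K(2)[of n] L(2)[of n] X Y borel_compact[OF K(1)] borel_compact[OF L(1)]
      by (simp add: measure_distr)
  qed
  then show "\<exists>K. compact K \<and> (\<forall>n. measure (distr M borel (\<lambda>\<omega>. (X n \<omega>, Y n \<omega>))) K \<ge> 1 - \<epsilon>)"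
    using compact_Times[OF K(1) L(1)] by blast
qed

lemma char_vec_pair_measure:
  fixes \<mu> :: "'a::euclidean_space measure" and \<nu> :: "'b::euclidean_space measure"
  assumes \<mu>: "prob_space \<mu>" "sets \<mu> = sets borel" and \<nu>: "prob_space \<nu>" "sets \<nu> = sets borel"
  shows "char_vec (\<mu> \<Otimes>\<^sub>M \<nu>) (t, s) = char_vec \<mu> t * char_vec \<nu> s"
proof -
  interpret A: prob_space \<mu> by fact
  interpret B: prob_space \<nu> by fact
  interpret pair_prob_space \<mu> \<nu> ..
  have int: "integrable (\<mu> \<Otimes>\<^sub>M \<nu>) (\<lambda>z. iexp ((t, s) \<bullet> z))"
    using integrable_trig_poly[OF prob_space_axioms sets_pair_borel[OF \<mu>(2) \<nu>(2)]]
      trig_poly.monomial[of 1 "(t, s)"] by simp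
  have "char_vec (\<mu> \<Otimes>\<^sub>M \<nu>) (t, s) = (LINT x|\<mu>. LINT y|\<nu>. iexp ((t, s) \<bullet> (x, y)))"
    unfolding char_vec_def using integral_fst'[OF int] by simp
  also have "\<dots> = (LINT x|\<mu>. LINT y|\<nu>. iexp (t \<bullet> x) * iexp (s \<bullet> y))"
    by (simp add: distrib_left exp_add)
  finally show ?thesis by (simp add: char_vec_def)
qed

section \<open>The equivalence\<close>

lemma uniformly_continuous_on_real_compose_inner:
  fixes g :: "real \<Rightarrow> real" and w :: "'a::real_inner"
  assumes "\<And>x y. \<bar>g x - g y\<bar> \<le> \<bar>x - y\<bar>"
  shows "uniformly_continuous_on UNIV (\<lambda>z. g (w \<bullet> z))"
proof -
  have "uniformly_continuous_on (range (\<lambda>z. w \<bullet> z)) g"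
    unfolding uniformly_continuous_on_def dist_real_def using assms le_less_trans by blast
  moreover have "uniformly_continuous_on UNIV (\<lambda>z. w \<bullet> z)"
    by (intro bounded_linear.uniformly_continuous_on[OF bounded_linear_inner_right] uniformly_continuous_on_id)
  ultimately show ?thesis
    using uniformly_continuous_on_compose[of UNIV "\<lambda>z. w \<bullet> z" g] by blast
qed

lemma abs_sin_diff: "\<bar>sin x - sin y\<bar> \<le> \<bar>x - y\<bar>" for x y :: real
proof -
  have "\<bar>sin x - sin y\<bar> = 2 * \<bar>sin ((x - y) / 2)\<bar> * \<bar>cos ((x + y) / 2)\<bar>"
    by (simp add: sin_diff_sin abs_mult)
  also have "\<dots> \<le> 2 * \<bar>(x - y) / 2\<bar> * 1"
    by (intro mult_mono mult_left_mono abs_sin_x_le_abs_x abs_cos_le_one) auto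
  finally show ?thesis by simp
qed

lemma abs_cos_diff: "\<bar>cos x - cos y\<bar> \<le> \<bar>x - y\<bar>" for x y :: real
  using abs_sin_diff[of "pi / 2 - x" "pi / 2 - y"] by (simp add: cos_sin_eq)

theorem proposition6:
  fixes M :: "'w measure"
    and X :: "nat \<Rightarrow> 'w \<Rightarrow> real ^ 'm"
    and Y :: "nat \<Rightarrow> 'w \<Rightarrow> real ^ 'k"
  assumes "prob_space M"
    and "\<And>n. X n \<in> borel_measurable M"
    and "\<And>n. Y n \<in> borel_measurable M"
    and "tight_seq (\<lambda>n. distr M borel (X n))"
    and "tight_seq (\<lambda>n. distr M borel (Y n))"
  shows "AI1 M X Y \<longleftrightarrow>
    (\<forall>t s. (\<lambda>n. char_vec (distr M borel (\<lambda>\<omega>. (X n \<omega>, Y n \<omega>))) (t, s)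
        - char_vec (distr M borel (X n)) t * char_vec (distr M borel (Y n)) s) \<longlonglongrightarrow> 0)"
proof -
  interpret prob_space M by fact
  let ?\<mu> = "\<lambda>n. distr M borel (\<lambda>\<omega>. (X n \<omega>, Y n \<omega>))"
  let ?\<alpha> = "\<lambda>n. distr M borel (X n)" and ?\<beta> = "\<lambda>n. distr M borel (Y n)"
  let ?\<nu> = "\<lambda>n. ?\<alpha> n \<Otimes>\<^sub>M ?\<beta> n"
  note [measurable] = assms(2,3)
  have \<mu>: "prob_space (?\<mu> n)" "sets (?\<mu> n) = sets borel" for n
    by (auto intro: prob_space_distr)
  have \<alpha>\<beta>: "prob_space (?\<alpha> n)" "prob_space (?\<beta> n)" for n
    by (auto intro: prob_space_distr)
  have \<nu>: "prob_space (?\<nu> n)" "sets (?\<nu> n) = sets borel" for n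
    by (rule prob_space_pair[OF \<alpha>\<beta>]) (rule sets_pair_borel; simp)
  have prod: "char_vec (?\<nu> n) (t, s) = char_vec (?\<alpha> n) t * char_vec (?\<beta> n) s" for n t s
    by (rule char_vec_pair_measure) (auto intro: \<alpha>\<beta>)
  show ?thesis
  proof
    assume AI: "AI1 M X Y"
    show "\<forall>t s. (\<lambda>n. char_vec (?\<mu> n) (t, s) - char_vec (?\<alpha> n) t * char_vec (?\<beta> n) s) \<longlonglongrightarrow> 0"
    proof (intro allI)
      fix t :: "real ^ 'm" and s :: "real ^ 'k"
      let ?e = "\<lambda>z. iexp ((t, s) \<bullet> z)"
      have lim: "(\<lambda>n. (LINT z|?\<mu> n. g ((t, s) \<bullet> z)) - (LINT z|?\<nu> n. g ((t, s) \<bullet> z))) \<longlonglongrightarrow> 0"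
        if "\<And>x y. \<bar>g x - g y\<bar> \<le> \<bar>x - y\<bar>" "\<And>x. \<bar>g x\<bar> \<le> 1" for g :: "real \<Rightarrow> real"
      proof -
        have "bounded (range (\<lambda>z. g ((t, s) \<bullet> z)))"
          using that(2) by (auto simp: bounded_iff)
        then show ?thesis
          using AI uniformly_continuous_on_real_compose_inner[of g "(t, s)"] that(1)
          unfolding AI1_def by blast
      qed
      have int: "integrable \<rho> ?e" if "prob_space \<rho>" "sets \<rho> = sets borel" for \<rho>
        using integrable_trig_poly[OF that trig_poly.monomial[of 1]] by simp
      have cmp: "char_vec \<rho> (t, s)
          = Complex (LINT z|\<rho>. cos ((t, s) \<bullet> z)) (LINT z|\<rho>. sin ((t, s) \<bullet> z))"
        if "prob_space \<rho>" "sets \<rho> = sets borel" for \<rho>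
        unfolding char_vec_def
        using integral_Re[OF int[OF that]] integral_Im[OF int[OF that]]
        by (simp add: complex_eq_iff Re_exp Im_exp del: inner_Pair)
      have "(\<lambda>n. Complex ((LINT z|?\<mu> n. cos ((t, s) \<bullet> z)) - (LINT z|?\<nu> n. cos ((t, s) \<bullet> z)))
          ((LINT z|?\<mu> n. sin ((t, s) \<bullet> z)) - (LINT z|?\<nu> n. sin ((t, s) \<bullet> z)))) \<longlonglongrightarrow> Complex 0 0"
        by (intro tendsto_Complex lim abs_cos_le_one abs_sin_le_one abs_sin_diff abs_cos_diff)
      then show "(\<lambda>n. char_vec (?\<mu> n) (t, s) - char_vec (?\<alpha> n) t * char_vec (?\<beta> n) s) \<longlonglongrightarrow> 0"
        unfolding prod[symmetric] cmp[OF \<mu>] cmp[OF \<nu>]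
        by (simp add: complex_diff zero_complex.code)
    qed
  next
    assume char: "\<forall>t s. (\<lambda>n. char_vec (?\<mu> n) (t, s) - char_vec (?\<alpha> n) t * char_vec (?\<beta> n) s) \<longlonglongrightarrow> 0"
    have char': "(\<lambda>n. char_vec (?\<mu> n) z - char_vec (?\<nu> n) z) \<longlonglongrightarrow> 0" for z
      using char by (cases z) (simp add: prod)
    have "tight_seq ?\<mu>" "tight_seq ?\<nu>"
      using tight_seq_distr_Pair[OF assms] tight_seq_pair_measure[OF \<alpha>\<beta>(1) _ assms(4) \<alpha>\<beta>(2) _ assms(5)]
      by simp_all
    then show "AI1 M X Y"
      unfolding AI1_def
      using integral_diff_tendsto_if_char_vec_diff_tendsto[OF \<mu> \<nu> _ _ char']
        uniformly_continuous_imp_continuous by blast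
  qed
qed

end
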